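(* Let $N=(P,T,\mathrm{Pre},\mathrm{Post},m_0)$ be a marked Petri net and let $(p,t)$ be a source-sink pair in $N$. Let $N'$ be the net obtained from $N$ by removing place $p$ and transition $t$. Then for every $z\in\mathbb{N}$ with $z\le m_0(p)$ and every marking $m:P\setminus\{p\}\to\mathbb{N}$, $$m\cup\{(p,z)\}\in\mathcal{R}(N)\iff m\in\mathcal{R}(N').$$
   Context: A marked Petri net is a tuple $N=(P,T,\mathrm{Pre},\mathrm{Post},m_0)$ with $P,T$ disjoint finite sets, $\mathrm{Pre},\mathrm{Post}:T\to(P\to\mathbb{N})$, and $m_0:P\to\mathbb{N}$. A marking is a map from places to $\mathbb{N}$, written as a set of pairs (place, value); a transition $t$ is enabled at $m$ if $m\ge\mathrm{Pre}(t)$ pointwise, and firing it yields $m-\mathrm{Pre}(t)+\mathrm{Post}(t)$. $\mathcal{R}(N)$ is the set of markings reachable from $m_0$. For a place $p$: ${}^\bullet p=\{t\mid\mathrm{Post}(t)(p)>0\}$ and $p^\bullet=\{t\mid\mathrm{Pre}(t)(p)>0\}$. A pair $(p,t)$ is a source-sink pair if ${}^\bullet p=\emptyset$, $p^\bullet=\{t\}$, $\mathrm{Pre}(t)$ equals $1$ on $p$ and $0$ elsewhere, and $\mathrm{Post}(t)$ is identically $0$. Removing $(p,t)$ yields the net with places $P\setminus\{p\}$ and transitions $T\setminus\{t\}$, with pre/post conditions and initial marking restricted accordingly. *)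

theory Defs
  imports Main "HOL-Library.FuncSet"
begin

text \<open>
  Places and transitions are drawn from one type, so that their disjointness is an actual condition.
  A function with domain \<open>A\<close> is represented by an extensional function in \<open>A \<rightarrow>\<^sub>E B\<close>, with value
  \<open>undefined\<close> outside \<open>A\<close>; equality of such functions is therefore equality on \<open>A\<close>.
\<close>

record 'a petri_net =
  places :: "'a set"
  transitions :: "'a set"
  pre :: "'a \<Rightarrow> 'a \<Rightarrow> nat"
  post :: "'a \<Rightarrow> 'a \<Rightarrow> nat"
  init :: "'a \<Rightarrow> nat"

definition markings :: "'a set \<Rightarrow> ('a \<Rightarrow> nat) set" where
  "markings A = A \<rightarrow>\<^sub>E UNIV"

definition marked_petri_net :: "'a petri_net \<Rightarrow> bool" where
  "marked_petri_net N \<longleftrightarrow>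
     finite (places N) \<and> finite (transitions N) \<and> places N \<inter> transitions N = {} \<and>
     pre N \<in> transitions N \<rightarrow>\<^sub>E markings (places N) \<and>
     post N \<in> transitions N \<rightarrow>\<^sub>E markings (places N) \<and>
     init N \<in> markings (places N)"

definition enabled :: "'a petri_net \<Rightarrow> 'a \<Rightarrow> ('a \<Rightarrow> nat) \<Rightarrow> bool" where
  "enabled N t m \<longleftrightarrow> (\<forall>q\<in>places N. pre N t q \<le> m q)"

definition fire :: "'a petri_net \<Rightarrow> 'a \<Rightarrow> ('a \<Rightarrow> nat) \<Rightarrow> ('a \<Rightarrow> nat)" where
  "fire N t m = (\<lambda>q\<in>places N. m q - pre N t q + post N t q)"

inductive_set reachable :: "'a petri_net \<Rightarrow> ('a \<Rightarrow> nat) set" for N where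
  initial: "init N \<in> reachable N"
| step: "\<lbrakk>m \<in> reachable N; t \<in> transitions N; enabled N t m\<rbrakk> \<Longrightarrow> fire N t m \<in> reachable N"

definition place_preset :: "'a petri_net \<Rightarrow> 'a \<Rightarrow> 'a set" where
  "place_preset N p = {t \<in> transitions N. post N t p > 0}"

definition place_postset :: "'a petri_net \<Rightarrow> 'a \<Rightarrow> 'a set" where
  "place_postset N p = {t \<in> transitions N. pre N t p > 0}"

definition source_sink_pair :: "'a petri_net \<Rightarrow> 'a \<Rightarrow> 'a \<Rightarrow> bool" where
  "source_sink_pair N p t \<longleftrightarrow>
     p \<in> places N \<and> t \<in> transitions N \<and>
     place_preset N p = {} \<and> place_postset N p = {t} \<and>
     (\<forall>q\<in>places N. pre N t q = (if q = p then 1 else 0)) \<and>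
     (\<forall>q\<in>places N. post N t q = 0)"

definition remove_pair :: "'a petri_net \<Rightarrow> 'a \<Rightarrow> 'a \<Rightarrow> 'a petri_net" where
  "remove_pair N p t =
     \<lparr>places = places N - {p},
      transitions = transitions N - {t},
      pre = (\<lambda>u\<in>transitions N - {t}. \<lambda>q\<in>places N - {p}. pre N u q),
      post = (\<lambda>u\<in>transitions N - {t}. \<lambda>q\<in>places N - {p}. post N u q),
      init = (\<lambda>q\<in>places N - {p}. init N q)\<rparr>"

lemma marked_petri_net_remove_pair:
  assumes "marked_petri_net N"
  shows "marked_petri_net (remove_pair N p t)"
  using assms by (auto simp: marked_petri_net_def remove_pair_def markings_def)

lemma reachable_markings:
  assumes "marked_petri_net N" "m \<in> reachable N"
  shows "m \<in> markings (places N)"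
  using assms(2,1)
  by (induction rule: reachable.induct) (auto simp: marked_petri_net_def markings_def fire_def)

end

theory Submission
  imports Defs
begin

text \<open>
  Firing \<open>t\<close> only removes a token from \<open>p\<close>, and no other transition touches \<open>p\<close>. Forgetting \<open>p\<close>
  therefore maps runs of the net to runs of the reduced net (occurrences of \<open>t\<close> become idle).
  Conversely, a run of the reduced net lifts to one in which \<open>p\<close> keeps its initial value, and
  firing \<open>t\<close> afterwards brings \<open>p\<close> down to any smaller value.
\<close>

lemma source_sink_pair_pre_eq_0:
  assumes "source_sink_pair N p t" "u \<in> transitions N" "u \<noteq> t"
  shows "pre N u p = 0"
  using assms by (auto simp: source_sink_pair_def place_postset_def)

lemma source_sink_pair_post_eq_0:
  assumes "source_sink_pair N p t" "u \<in> transitions N"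
  shows "post N u p = 0"
  using assms by (auto simp: source_sink_pair_def place_preset_def)

lemma fire_source_sink_pair:
  assumes "source_sink_pair N p t" "m \<in> markings (places N)"
  shows "fire N t m = m(p := m p - 1)"
  using assms
  by (auto simp: source_sink_pair_def fire_def markings_def PiE_def extensional_def fun_eq_iff)

lemma enabled_source_sink_pair_iff:
  assumes "source_sink_pair N p t"
  shows "enabled N t m \<longleftrightarrow> m p > 0"
  using assms by (auto simp: source_sink_pair_def enabled_def)

text \<open>The only condition lost with \<open>p\<close> is the one at \<open>p\<close> itself,
  which is trivial because \<open>u\<close> consumes nothing there.\<close>

lemma enabled_remove_pair_iff:
  assumes "source_sink_pair N p t" "u \<in> transitions N" "u \<noteq> t"
  shows "enabled (remove_pair N p t) u (restrict m (places N - {p})) \<longleftrightarrow> enabled N u m"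
  using assms source_sink_pair_pre_eq_0[OF assms] by (auto simp: enabled_def remove_pair_def)

text \<open>Firing is computed place by place, so it commutes with forgetting a place.\<close>

lemma fire_remove_pair:
  assumes "u \<in> transitions N" "u \<noteq> t"
  shows "fire (remove_pair N p t) u (restrict m (places N - {p})) =
           restrict (fire N u m) (places N - {p})"
  using assms by (auto simp: fire_def remove_pair_def fun_eq_iff)

lemma restrict_reachable_remove_pair:
  assumes "marked_petri_net N" "source_sink_pair N p t" "m \<in> reachable N"
  shows "restrict m (places N - {p}) \<in> reachable (remove_pair N p t)"
  using assms(3)
proof induction
  case initial
  have "init (remove_pair N p t) = restrict (init N) (places N - {p})"
    by (simp add: remove_pair_def)
  then show "restrict (init N) (places N - {p}) \<in> reachable (remove_pair N p t)"
    using reachable.initial by metis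
next
  case (step m u)
  show ?case
  proof (cases "u = t")
    case True
    have "restrict (fire N t m) (places N - {p}) = restrict m (places N - {p})"
      using fire_source_sink_pair[OF assms(2) reachable_markings[OF assms(1) step.hyps(1)]]
      by (auto simp: fun_eq_iff)
    with True step.IH show ?thesis
      by simp
  next
    case False
    have "restrict m (places N - {p}) \<in> reachable (remove_pair N p t)"
      by (fact step.IH)
    moreover have "u \<in> transitions (remove_pair N p t)"
      using step.hyps(2) False by (simp add: remove_pair_def)
    moreover have "enabled (remove_pair N p t) u (restrict m (places N - {p}))"
      using enabled_remove_pair_iff[OF assms(2) step.hyps(2) False] step.hyps(3) by blast
    ultimately have "fire (remove_pair N p t) u (restrict m (places N - {p}))
                       \<in> reachable (remove_pair N p t)"
      by (rule reachable.step)
    then show ?thesis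
      using fire_remove_pair step.hyps(2) False by metis
  qed
qed

lemma reachable_remove_pair_lift:
  assumes "marked_petri_net N" "source_sink_pair N p t" "m \<in> reachable (remove_pair N p t)"
  shows "m(p := init N p) \<in> reachable N"
  using assms(3)
proof induction
  case initial
  \<comment> \<open>The reduced initial marking is \<open>undefined\<close> at \<open>p\<close>; the
    update puts the original value back.\<close>
  have "(init (remove_pair N p t))(p := init N p) = init N"
    using assms(1)
    by (auto simp: remove_pair_def marked_petri_net_def markings_def PiE_def extensional_def
        fun_eq_iff)
  then show ?case
    using reachable.initial[of N] by simp
next
  case (step m u)
  have u: "u \<in> transitions N" "u \<noteq> t"
    using step.hyps(2) by (auto simp: remove_pair_def)
  have p: "p \<in> places N"
    using assms(2) by (simp add: source_sink_pair_def)
  have "enabled N u (m(p := init N p))"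
    using step.hyps(3) u source_sink_pair_pre_eq_0[OF assms(2) u]
    by (auto simp: enabled_def remove_pair_def)
  with step.IH u(1) have "fire N u (m(p := init N p)) \<in> reachable N"
    by (rule reachable.step)
  \<comment> \<open>At \<open>p\<close>, the transition \<open>u\<close> neither consumes nor
    produces, so the left side keeps the value \<open>init N p\<close> there.\<close>
  moreover have "fire N u (m(p := init N p)) = (fire (remove_pair N p t) u m)(p := init N p)"
    using u p source_sink_pair_pre_eq_0[OF assms(2) u]
      source_sink_pair_post_eq_0[OF assms(2) u(1)]
    by (auto simp: fire_def remove_pair_def fun_eq_iff)
  ultimately show "(fire (remove_pair N p t) u m)(p := init N p) \<in> reachable N"
    by (simp only:)
qed

lemma reachable_lower_source:
  assumes "marked_petri_net N" "source_sink_pair N p t" "m \<in> reachable N" "z \<le> m p"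
  shows "m(p := z) \<in> reachable N"
  using assms(4)
\<comment> \<open>The induction descends from \<open>m p\<close> to \<open>z\<close>: a marking with
  \<open>Suc k\<close> tokens on \<open>p\<close> enables \<open>t\<close>, and one firing leaves
  \<open>k\<close>.\<close>
proof (induction rule: inc_induct)
  case base
  show ?case
    using assms(3) by simp
next
  case (step k)
  let ?m = "m(p := Suc k)"
  have m: "?m \<in> reachable N"
    by (fact step.IH)
  moreover have "t \<in> transitions N"
    using assms(2) by (simp add: source_sink_pair_def)
  moreover have "enabled N t ?m"
    using enabled_source_sink_pair_iff[OF assms(2)] by simp
  ultimately have "fire N t ?m \<in> reachable N"
    by (rule reachable.step)
  moreover have "fire N t ?m = m(p := k)"
    using fire_source_sink_pair[OF assms(2) reachable_markings[OF assms(1) m]] by simp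
  ultimately show "m(p := k) \<in> reachable N"
    by (simp only:)
qed

theorem theorem4:
  fixes N :: "'a petri_net" and p t :: 'a
  assumes "marked_petri_net N"
    and "source_sink_pair N p t"
  shows "\<forall>z. z \<le> init N p \<longrightarrow>
           (\<forall>m \<in> markings (places N - {p}).
              m(p := z) \<in> reachable N \<longleftrightarrow> m \<in> reachable (remove_pair N p t))"
proof (intro allI impI ballI iffI)
  fix z m
  assume m: "m \<in> markings (places N - {p})" and "m(p := z) \<in> reachable N"
  from restrict_reachable_remove_pair[OF assms this(2)]
  have "restrict (m(p := z)) (places N - {p}) \<in> reachable (remove_pair N p t)" .
  \<comment> \<open>As a marking of the remaining places, \<open>m\<close> is
    \<open>undefined\<close> at \<open>p\<close>, which is the value that restriction
    restores.\<close>
  moreover have "restrict (m(p := z)) (places N - {p}) = m"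
    using m by (auto simp: markings_def PiE_def extensional_def fun_eq_iff)
  ultimately show "m \<in> reachable (remove_pair N p t)"
    by simp
next
  fix z m
  assume "z \<le> init N p" and "m \<in> reachable (remove_pair N p t)"
  then show "m(p := z) \<in> reachable N"
    \<comment> \<open>The lifted marking carries \<open>init N p\<close> tokens on \<open>p\<close>,
      so the bound on \<open>z\<close> is the one required; the update to \<open>z\<close> then
      overrides the earlier one.\<close>
    using reachable_lower_source[OF assms reachable_remove_pair_lift[OF assms], of m z] by simp
qed

end
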